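(* Let $\mathcal{P}$ be a convex polyomino and let $T$ be a triangulation of $\mathcal{P}$. Then $T$ is word-representable if and only if $T$ is $3$-colorable.
   Context: A polyomino is a plane figure formed by joining finitely many equal unit squares edge to edge. It is regarded as a graph whose vertices are the corners of its squares and whose edges are the sides of its squares. A polyomino is column convex if its intersection with every vertical line is convex (connected), row convex if its intersection with every horizontal line is convex, and convex if it is both. A triangulation of a polyomino is the graph obtained from the polyomino's graph by adding, in each unit square of the polyomino, exactly one of its two diagonals as an edge. A graph $G=(V,E)$ is word-representable if there is a word $w$ over the alphabet $V$ such that for all distinct $x,y\in V$, the letters $x$ and $y$ alternate in $w$ if and only if $\{x,y\}\in E$. A graph is $k$-colorable if its vertices can be colored with at most $k$ colors so that adjacent vertices receive different colors. *)

theory Defs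
  imports "HOL-Analysis.Analysis"
begin

type_synonym 'a graph = "'a set \<times> 'a set set"

definition alternate :: "'a list \<Rightarrow> 'a \<Rightarrow> 'a \<Rightarrow> bool" where
  "alternate w x y \<longleftrightarrow> distinct_adj (filter (\<lambda>z. z = x \<or> z = y) w)"

definition word_representable :: "'a graph \<Rightarrow> bool" where
  "word_representable G \<longleftrightarrow>
     (\<exists>w. set w \<subseteq> fst G \<and>
          (\<forall>x\<in>fst G. \<forall>y\<in>fst G. x \<noteq> y \<longrightarrow> (alternate w x y \<longleftrightarrow> {x, y} \<in> snd G)))"

definition colorable :: "nat \<Rightarrow> 'a graph \<Rightarrow> bool" where
  "colorable k G \<longleftrightarrow>
     (\<exists>c :: 'a \<Rightarrow> nat. c ` fst G \<subseteq> {..<k} \<and>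
        (\<forall>x\<in>fst G. \<forall>y\<in>fst G. {x, y} \<in> snd G \<longrightarrow> c x \<noteq> c y))"

text \<open>Many authors also require every letter of \<open>V\<close> to occur in the representing word.
  For finite graphs this makes no difference.\<close>

lemma word_representable_iff_all_letters:
  assumes "finite (fst G)"
  shows "word_representable G \<longleftrightarrow>
     (\<exists>w. set w = fst G \<and>
          (\<forall>x\<in>fst G. \<forall>y\<in>fst G. x \<noteq> y \<longrightarrow> (alternate w x y \<longleftrightarrow> {x, y} \<in> snd G)))"
    (is "_ = ?R")
proof
  assume "word_representable G"
  then obtain w where w: "set w \<subseteq> fst G"
    and alt: "\<forall>x\<in>fst G. \<forall>y\<in>fst G. x \<noteq> y \<longrightarrow> (alternate w x y \<longleftrightarrow> {x, y} \<in> snd G)"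
    unfolding word_representable_def by (elim exE conjE)
  obtain m where m: "set m = fst G - set w" "distinct m"
    using finite_distinct_list[OF finite_Diff[OF assms, of "set w"]] by blast
  have single: "filter (\<lambda>z. z = x) m = (if x \<in> set m then [x] else [])" for x
    using m(2) by (induction m) (auto simp: filter_empty_conv)
  have key: "alternate (m @ w) x y \<longleftrightarrow> alternate w x y"
    if "x \<in> fst G" "y \<in> fst G" "x \<noteq> y" for x y
  proof -
    have both: ?thesis if "x \<notin> set w" "y \<notin> set w" "x \<in> set m" "y \<in> set m"
    proof -
      have "filter (\<lambda>z. z = x \<or> z = y) w = []"
        using that by (auto simp: filter_empty_conv)
      moreover have "distinct_adj (filter (\<lambda>z. z = x \<or> z = y) m)"
        using distinct_filter[OF m(2)]
        by (auto simp: distinct_adj_conv_nth nth_eq_iff_index_eq)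
      ultimately show ?thesis by (simp add: alternate_def)
    qed
    have one: "alternate (m @ w) x y \<longleftrightarrow> alternate w x y"
      if "x \<notin> set w" "x \<in> set m" "y \<in> set w" "x \<noteq> y" for x y
    proof -
      have "filter (\<lambda>z. z = x \<or> z = y) w = filter (\<lambda>z. z = y) w"
        using that by (intro filter_cong) auto
      moreover have "filter (\<lambda>z. z = x \<or> z = y) m = filter (\<lambda>z. z = x) m"
        using that m by (intro filter_cong) auto
      moreover have "filter (\<lambda>z. z = y) w = [] \<or> hd (filter (\<lambda>z. z = y) w) = y"
        by (induction w) auto
      ultimately show ?thesis
        using single[of x] that
        by (cases "filter (\<lambda>z. z = y) w") (simp_all add: alternate_def)
    qed
    have none: ?thesis if "x \<in> set w" "y \<in> set w"
    proof -
      have "filter (\<lambda>z. z = x \<or> z = y) m = []"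
        using that m by (auto simp: filter_empty_conv)
      then show ?thesis by (simp add: alternate_def)
    qed
    have comm: "alternate u x y = alternate u y x" for u
      unfolding alternate_def by (simp add: disj_commute)
    show ?thesis
    proof (cases "x \<in> set w")
      case True
      show ?thesis
      proof (cases "y \<in> set w")
        case True
        with \<open>x \<in> set w\<close> show ?thesis by (rule none)
      next
        case False
        then have "alternate (m @ w) y x \<longleftrightarrow> alternate w y x"
          using one[of y x] that m(1) True by auto
        then show ?thesis using comm[of "m @ w"] comm[of w] by argo
      qed
    next
      case False
      then show ?thesis using one[of x y] both that m(1) by auto
    qed
  qed
  show ?R
  proof (intro exI[of _ "m @ w"] conjI ballI impI)
    show "set (m @ w) = fst G" using w m(1) by auto
  next
    fix x y assume "x \<in> fst G" "y \<in> fst G" "x \<noteq> y"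
    then show "alternate (m @ w) x y \<longleftrightarrow> {x, y} \<in> snd G"
      using alt key by simp
  qed
next
  assume ?R
  then show "word_representable G"
    unfolding word_representable_def by (elim ex_forward conj_forward) auto
qed

text \<open>The cell \<open>(i, j)\<close> stands for the unit square \<open>[i, i+1] \<times> [j, j+1]\<close>.\<close>

type_synonym cell = "int \<times> int"
type_synonym point = "int \<times> int"

fun square :: "cell \<Rightarrow> (real \<times> real) set" where
  "square (i, j) = {of_int i..of_int i + 1} \<times> {of_int j..of_int j + 1}"

fun corners :: "cell \<Rightarrow> point set" where
  "corners (i, j) = {(i, j), (i + 1, j), (i, j + 1), (i + 1, j + 1)}"

fun sides :: "cell \<Rightarrow> point set set" where
  "sides (i, j) =
     {{(i, j), (i + 1, j)}, {(i, j + 1), (i + 1, j + 1)},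
      {(i, j), (i, j + 1)}, {(i + 1, j), (i + 1, j + 1)}}"

fun diagonals :: "cell \<Rightarrow> point set set" where
  "diagonals (i, j) = {{(i, j), (i + 1, j + 1)}, {(i + 1, j), (i, j + 1)}}"

definition polyomino :: "cell set \<Rightarrow> bool" where
  "polyomino P \<longleftrightarrow> finite P \<and> P \<noteq> {} \<and>
     (\<forall>a\<in>P. \<forall>b\<in>P. (a, b) \<in> {(c, d). c \<in> P \<and> d \<in> P \<and> sides c \<inter> sides d \<noteq> {}}\<^sup>*)"

definition figure :: "cell set \<Rightarrow> (real \<times> real) set" where
  "figure P = (\<Union>c\<in>P. square c)"

definition column_convex :: "cell set \<Rightarrow> bool" where
  "column_convex P \<longleftrightarrow> (\<forall>x. convex (figure P \<inter> {p. fst p = x}))"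

definition row_convex :: "cell set \<Rightarrow> bool" where
  "row_convex P \<longleftrightarrow> (\<forall>y. convex (figure P \<inter> {p. snd p = y}))"

definition convex_polyomino :: "cell set \<Rightarrow> bool" where
  "convex_polyomino P \<longleftrightarrow> polyomino P \<and> column_convex P \<and> row_convex P"

definition polyomino_graph :: "cell set \<Rightarrow> point graph" where
  "polyomino_graph P = (\<Union>c\<in>P. corners c, \<Union>c\<in>P. sides c)"

definition triangulation_of :: "cell set \<Rightarrow> point graph \<Rightarrow> bool" where
  "triangulation_of P T \<longleftrightarrow>
     (\<exists>D. (\<forall>c\<in>P. D c \<in> diagonals c) \<and>
          T = (fst (polyomino_graph P), snd (polyomino_graph P) \<union> D ` P))"

end

theory Submission
  imports Defs
begin

text \<open>
  In a word-representable graph, the neighbours of a vertex \<open>v\<close> are preordered by their numbers of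
  occurrences in all prefixes of the word, shifted so that each of them stays within one of the
  count of \<open>v\<close>, and two neighbours are comparable exactly if they are adjacent. Hence there is no
  induced odd wheel, so that every \<open>2 \<times> 2\<close> block of cells contains an even number of diagonals of
  each direction. Recording the directions as signs \<open>\<sigma>\<close>, row and column convexity turn this local
  condition into a factorization \<open>\<sigma> (i, j) = H i * V j\<close>, and the sums of \<open>H\<close> and of \<open>V\<close> up to the
  coordinates of a point, added modulo 3, are a proper coloring.

  Conversely, every finite 3-colorable graph is word-representable: for each non-edge there is a
  word in which that pair fails to alternate while all edges alternate starting with the smaller
  color, and the concatenation of these words represents the graph.
\<close>

section \<open>Alternation and prefix counts\<close>

lemma alternate_commute: "alternate w x y = alternate w y x"
  unfolding alternate_def by (simp add: disj_commute)

text \<open>Integer-valued, since the difference may be negative. As \<open>take\<close> saturates,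
  \<open>n\<close> may range over all naturals, including those beyond the length of
  \<open>w\<close>.\<close>

definition balance :: "'a list \<Rightarrow> 'a \<Rightarrow> 'a \<Rightarrow> nat \<Rightarrow> int" where
  "balance w x y n = int (count_list (take n w) x) - int (count_list (take n w) y)"

lemma balance_0 [simp]: "balance w x y 0 = 0"
  by (simp add: balance_def)

lemma balance_Cons_Suc:
  "balance (a # w) x y (Suc n) =
     balance w x y n + (if a = x then 1 else 0) - (if a = y then 1 else 0)"
  by (simp add: balance_def)

lemma balance_swap: "balance w y x n = - balance w x y n"
  by (simp add: balance_def)

lemma all_nat_0_Suc: "(\<forall>n. Q n) \<longleftrightarrow> Q 0 \<and> (\<forall>n. Q (Suc n))" for Q :: "nat \<Rightarrow> bool"
  by (metis not0_implies_Suc)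

text \<open>After a leading \<open>x\<close>, the balance of the tail must lie in {-1, 0}. This is
  the same condition with \<open>x\<close> and \<open>y\<close> exchanged, hence the induction over
  arbitrary \<open>x\<close> and \<open>y\<close>. A leading \<open>y\<close> gives -1 at
  once.\<close>

lemma balance_01_iff:
  assumes "x \<noteq> y"
  shows "(\<forall>n. 0 \<le> balance w x y n \<and> balance w x y n \<le> 1) \<longleftrightarrow>
    alternate w x y \<and>
    (filter (\<lambda>z. z = x \<or> z = y) w = [] \<or> hd (filter (\<lambda>z. z = x \<or> z = y) w) = x)"
  using assms
proof (induction w arbitrary: x y)
  case Nil
  then show ?case by (simp add: balance_def alternate_def)
next
  case (Cons a w)
  consider "a = x" | "a = y" | "a \<noteq> x" "a \<noteq> y" by blast
  then show ?case
  proof cases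
    case 1
    have "(\<forall>n. 0 \<le> balance (a # w) x y n \<and> balance (a # w) x y n \<le> 1) \<longleftrightarrow>
        (\<forall>n. 0 \<le> balance w y x n \<and> balance w y x n \<le> 1)"
      using 1 Cons.prems
      by (subst all_nat_0_Suc) (simp add: balance_Cons_Suc balance_swap[of w y x], smt (verit))
    also have "\<dots> \<longleftrightarrow> alternate w y x \<and>
        (filter (\<lambda>z. z = y \<or> z = x) w = [] \<or> hd (filter (\<lambda>z. z = y \<or> z = x) w) = y)"
      using Cons.prems by (intro Cons.IH) simp
    also have "\<dots> \<longleftrightarrow> alternate (a # w) x y"
    proof -
      have eq: "(\<lambda>z. z = y \<or> z = x) = (\<lambda>z. z = x \<or> z = y)" by auto
      have "set (filter (\<lambda>z. z = x \<or> z = y) w) \<subseteq> {x, y}" by auto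
      then show ?thesis
        unfolding alternate_def eq using 1 Cons.prems
        by (cases "filter (\<lambda>z. z = x \<or> z = y) w") auto
    qed
    finally show ?thesis using 1 by simp
  next
    case 2
    have "balance (a # w) x y (Suc 0) = - 1"
      using 2 Cons.prems by (simp add: balance_Cons_Suc)
    then have "\<not> (\<forall>n. 0 \<le> balance (a # w) x y n \<and> balance (a # w) x y n \<le> 1)"
      by (metis neg_0_le_iff_le not_one_le_zero)
    then show ?thesis using 2 Cons.prems by simp
  next
    case 3
    have "(\<forall>n. 0 \<le> balance (a # w) x y n \<and> balance (a # w) x y n \<le> 1) \<longleftrightarrow>
        (\<forall>n. 0 \<le> balance w x y n \<and> balance w x y n \<le> 1)"
      using 3 by (subst all_nat_0_Suc) (auto simp: balance_Cons_Suc)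
    then show ?thesis using 3 Cons by (simp add: alternate_def)
  qed
qed

text \<open>The empty prefix has balance 0, so a window from \<open>k\<close> to
  \<open>k + 1\<close> must have \<open>k = 0\<close> or \<open>k = -1\<close>. The two values
  record whether \<open>x\<close> or \<open>y\<close> may come first.\<close>

lemma alternate_iff_balance:
  assumes "x \<noteq> y"
  shows "alternate w x y \<longleftrightarrow> (\<exists>k. \<forall>n. k \<le> balance w x y n \<and> balance w x y n \<le> k + 1)"
proof
  assume alt: "alternate w x y"
  have eq: "(\<lambda>z. z = y \<or> z = x) = (\<lambda>z. z = x \<or> z = y)" by auto
  have "set (filter (\<lambda>z. z = x \<or> z = y) w) \<subseteq> {x, y}" by auto
  then have "filter (\<lambda>z. z = x \<or> z = y) w = [] \<or> hd (filter (\<lambda>z. z = x \<or> z = y) w) = x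
      \<or> hd (filter (\<lambda>z. z = x \<or> z = y) w) = y"
    by (cases "filter (\<lambda>z. z = x \<or> z = y) w") auto
  then have "(\<forall>n. 0 \<le> balance w x y n \<and> balance w x y n \<le> 1) \<or>
      (\<forall>n. 0 \<le> balance w y x n \<and> balance w y x n \<le> 1)"
    using alt alternate_commute[of w x y] assms
    unfolding balance_01_iff[OF assms] balance_01_iff[OF assms[symmetric]] eq by blast
  then show "\<exists>k. \<forall>n. k \<le> balance w x y n \<and> balance w x y n \<le> k + 1"
  proof
    assume "\<forall>n. 0 \<le> balance w x y n \<and> balance w x y n \<le> 1"
    then show ?thesis by (intro exI[of _ 0]) simp
  next
    assume "\<forall>n. 0 \<le> balance w y x n \<and> balance w y x n \<le> 1"
    then show ?thesis by (intro exI[of _ "- 1"]) (simp add: balance_swap[of w y x])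
  qed
next
  assume "\<exists>k. \<forall>n. k \<le> balance w x y n \<and> balance w x y n \<le> k + 1"
  then obtain k where k: "\<And>n. k \<le> balance w x y n \<and> balance w x y n \<le> k + 1" by blast
  from k[of 0] have "k = 0 \<or> k = - 1" by auto
  then show "alternate w x y"
  proof
    assume "k = 0"
    then have "\<forall>n. 0 \<le> balance w x y n \<and> balance w x y n \<le> 1" using k by simp
    then show ?thesis using balance_01_iff[OF assms] by blast
  next
    assume "k = - 1"
    then have "\<forall>n. 0 \<le> balance w y x n \<and> balance w y x n \<le> 1"
      using k by (simp add: balance_swap[of w y x])
    then show ?thesis
      using balance_01_iff[OF assms[symmetric]] alternate_commute[of w x y] by blast
  qed
qed

section \<open>Odd wheels\<close>

text \<open>Alternation with \<open>v\<close> confines the count of each neighbour, once shifted, to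
  two consecutive values. If one shifted count dominates another in all prefixes, their difference
  is thus 0 or 1, which is alternation.\<close>

lemma word_representable_neighbourhood_preorder:
  assumes "word_representable G" and "v \<in> fst G" "N \<subseteq> fst G" "v \<notin> N"
    and nb: "\<And>u. u \<in> N \<Longrightarrow> {v, u} \<in> snd G"
  obtains R where "\<And>x y z. R x y \<Longrightarrow> R y z \<Longrightarrow> R x z"
    and "\<And>x y. x \<in> N \<Longrightarrow> y \<in> N \<Longrightarrow> x \<noteq> y \<Longrightarrow> R x y \<or> R y x \<longleftrightarrow> {x, y} \<in> snd G"
proof -
  from assms(1) obtain w where
    "\<forall>x\<in>fst G. \<forall>y\<in>fst G. x \<noteq> y \<longrightarrow> (alternate w x y \<longleftrightarrow> {x, y} \<in> snd G)"
    unfolding word_representable_def by (elim exE conjE)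
  then have w: "alternate w x y \<longleftrightarrow> {x, y} \<in> snd G"
    if "x \<in> fst G" "y \<in> fst G" "x \<noteq> y" for x y
    using that by simp
  have "\<forall>u\<in>N. \<exists>k. \<forall>n. k \<le> balance w v u n \<and> balance w v u n \<le> k + 1"
  proof
    fix u assume u: "u \<in> N"
    then have "u \<in> fst G" "v \<noteq> u" using assms by auto
    then have "alternate w v u" using w[of v u] nb[OF u] assms(2) by blast
    then show "\<exists>k. \<forall>n. k \<le> balance w v u n \<and> balance w v u n \<le> k + 1"
      using alternate_iff_balance[OF \<open>v \<noteq> u\<close>] by blast
  qed
  then obtain k where
    k: "\<And>u n. u \<in> N \<Longrightarrow> k u \<le> balance w v u n \<and> balance w v u n \<le> k u + 1"
    by metis
  \<comment> \<open>The offsets \<open>k u\<close> normalise the counts so that, in every prefix, the count of a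
    neighbour equals that of \<open>v\<close> or is one less.\<close>
  define R where "R x y \<longleftrightarrow> (\<forall>n. k y - k x \<le> balance w x y n)" for x y
  show thesis
  proof (rule that[of R])
    fix x y z assume "R x y" "R y z"
    show "R x z"
      unfolding R_def
    proof
      fix n
      have "k y - k x \<le> balance w x y n" "k z - k y \<le> balance w y z n"
        using \<open>R x y\<close> \<open>R y z\<close> unfolding R_def by auto
      then show "k z - k x \<le> balance w x z n" by (simp add: balance_def)
    qed
  next
    have bound: "balance w x y n \<le> k y - k x + 1" if "x \<in> N" "y \<in> N" for x y n
      using k[OF that(1), of n] k[OF that(2), of n] by (simp add: balance_def)
    fix x y assume xy: "x \<in> N" "y \<in> N" "x \<noteq> y"
    have edge: "alternate w x y \<longleftrightarrow> {x, y} \<in> snd G"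
      using w xy assms(3) by blast
    have "R x y \<or> R y x \<longleftrightarrow> alternate w x y"
    proof
      assume "R x y \<or> R y x"
      then show "alternate w x y"
      proof
        assume "R x y"
        then have "\<forall>n. k y - k x \<le> balance w x y n \<and> balance w x y n \<le> (k y - k x) + 1"
          unfolding R_def using bound[OF xy(1,2)] by simp
        then show ?thesis unfolding alternate_iff_balance[OF xy(3)] by blast
      next
        assume "R y x"
        then have "\<forall>n. k x - k y \<le> balance w y x n \<and> balance w y x n \<le> (k x - k y) + 1"
          unfolding R_def using bound[OF xy(2,1)] by simp
        then have "alternate w y x"
          unfolding alternate_iff_balance[OF xy(3)[symmetric]] by blast
        then show ?thesis by (simp add: alternate_commute[of w x y])
      qed
    next
      assume "alternate w x y"
      then obtain m where m: "\<And>n. m \<le> balance w x y n \<and> balance w x y n \<le> m + 1"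
        unfolding alternate_iff_balance[OF xy(3)] by blast
      show "R x y \<or> R y x"
      \<comment> \<open>A window of width one either starts at or above \<open>k y - k x\<close> or
        ends at or below it; so one shifted count dominates the other.\<close>
      proof (cases "k y - k x \<le> m")
        case True
        then have "R x y" unfolding R_def using m order_trans by blast
        then show ?thesis ..
      next
        case False
        have "k x - k y \<le> balance w y x n" for n
          using m[of n] False by (simp add: balance_swap[of w y x])
        then have "R y x" unfolding R_def by blast
        then show ?thesis ..
      qed
    qed
    then show "R x y \<or> R y x \<longleftrightarrow> {x, y} \<in> snd G" using edge by simp
  qed
qed

text \<open>If two successive rim edges were oriented the same way by the preorder, transitivity
  would make rim vertices two apart comparable, hence adjacent. So orientations alternate around the
  rim, which is impossible for odd length.\<close>

lemma odd_wheel_not_word_representable: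
  assumes "v \<in> fst G" "set xs \<subseteq> fst G" "v \<notin> set xs"
    and spoke: "\<And>u. u \<in> set xs \<Longrightarrow> {v, u} \<in> snd G"
    and rim: "\<And>x y. (x, y) \<in> set (zip xs (rotate 1 xs)) \<Longrightarrow> x \<noteq> y \<and> {x, y} \<in> snd G"
    and chord: "\<And>x y. (x, y) \<in> set (zip xs (rotate 2 xs)) \<Longrightarrow> x \<noteq> y \<and> {x, y} \<notin> snd G"
    and "odd (length xs)"
  shows "\<not> word_representable G"
proof
  assume "word_representable G"
  from this assms(1-3) spoke obtain R where
    trans: "\<And>x y z. R x y \<Longrightarrow> R y z \<Longrightarrow> R x z" and
    comp: "\<And>x y. x \<in> set xs \<Longrightarrow> y \<in> set xs \<Longrightarrow> x \<noteq> y \<Longrightarrow> R x y \<or> R y x \<longleftrightarrow> {x, y} \<in> snd G"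
    by (rule word_representable_neighbourhood_preorder) (use spoke in blast)+
  let ?l = "length xs"
  have l: "?l > 0" using \<open>odd ?l\<close> by (cases xs) auto
  \<comment> \<open>Periodic indexing turns a tour of the rim into an induction on naturals: after
    \<open>?l\<close> steps the same edge returns, with an odd number of flips.\<close>
  define f where "f i = xs ! (i mod ?l)" for i
  have f_in: "f i \<in> set xs" for i unfolding f_def using l by simp
  have f_zip: "(f i, f (i + m)) \<in> set (zip xs (rotate m xs))" for i m
  proof -
    have "rotate m xs ! (i mod ?l) = xs ! ((m + i mod ?l) mod ?l)"
      using l by (intro nth_rotate) simp
    also have "\<dots> = f (i + m)" unfolding f_def by (simp add: mod_simps add.commute)
    finally show ?thesis
      unfolding set_zip using l by (auto simp: f_def intro!: exI[of _ "i mod ?l"])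
  qed
  have adj: "R (f i) (f (Suc i)) \<or> R (f (Suc i)) (f i)" for i
    using comp[OF f_in f_in] rim[OF f_zip[of i 1]] by simp
  have nonadj: "\<not> R (f i) (f (Suc (Suc i)))" "\<not> R (f (Suc (Suc i))) (f i)" for i
    using comp[OF f_in f_in] chord[OF f_zip[of i 2]] by auto
  have flip: "R (f (Suc i)) (f (Suc (Suc i))) \<longleftrightarrow> \<not> R (f i) (f (Suc i))" for i
    using adj[of i] adj[of "Suc i"] nonadj[of i] trans by blast
  have "R (f i) (f (Suc i)) \<longleftrightarrow> (even i \<longleftrightarrow> R (f 0) (f (Suc 0)))" for i
    by (induction i) (auto simp: flip)
  from this[of ?l] have "R (f ?l) (f (Suc ?l)) \<longleftrightarrow> \<not> R (f 0) (f (Suc 0))"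
    using \<open>odd ?l\<close> by simp
  moreover have "f ?l = f 0" "f (Suc ?l) = f (Suc 0)"
    unfolding f_def by (simp_all add: mod_Suc)
  ultimately show False by simp
qed

section \<open>Three-colorable graphs\<close>

text \<open>The case of both letters in \<open>xs\<close> is left out: \<open>xs\<close> will be a
  color class, perhaps with one vertex removed, and \<open>x\<close> and \<open>y\<close> will have
  different colors.\<close>

lemma filter_doubleton_distinct:
  assumes "distinct xs"
  shows "x \<in> set xs \<Longrightarrow> y \<notin> set xs \<Longrightarrow> filter (\<lambda>z. z = x \<or> z = y) xs = [x]"
    and "x \<notin> set xs \<Longrightarrow> y \<in> set xs \<Longrightarrow> filter (\<lambda>z. z = x \<or> z = y) xs = [y]"
    and "x \<notin> set xs \<Longrightarrow> y \<notin> set xs \<Longrightarrow> filter (\<lambda>z. z = x \<or> z = y) xs = []"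
  using assms by (induction xs) (auto simp: filter_empty_conv)

lemma not_alternate_append:
  "\<not> alternate w x y \<Longrightarrow> \<not> alternate (u @ w @ u') x y"
  unfolding alternate_def by (auto simp: distinct_adj_append_iff)

lemma distinct_adj_concat_replicate:
  "x \<noteq> y \<Longrightarrow> distinct_adj (concat (replicate n [x, y]))"
proof (induction n)
  case (Suc n)
  then show ?case by (cases n) auto
qed simp

lemma filter_concat_replicate:
  assumes "\<And>w. w \<in> set ws \<Longrightarrow> \<exists>n. filter Q w = concat (replicate n us)"
  shows "\<exists>n. filter Q (concat ws) = concat (replicate n us)"
  using assms
proof (induction ws)
  case Nil
  then show ?case by (intro exI[of _ 0]) simp
next
  case (Cons w ws)
  then obtain m n where "filter Q w = concat (replicate m us)"
    "filter Q (concat ws) = concat (replicate n us)"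
    by (meson list.set_intros)
  then have "filter Q (concat (w # ws)) = concat (replicate (m + n) us)"
    by (simp add: replicate_add)
  then show ?case by blast
qed

text \<open>Failure to alternate in a factor persists in the whole word. Alternation alone does not
  survive concatenation (\<open>xy\<close> followed by \<open>yx\<close>), but being a power of a
  fixed block \<open>[x, y]\<close> does; the colors decide which letter leads the block.\<close>

lemma word_representable_if_pieces:
  fixes c :: "'a \<Rightarrow> nat"
  assumes "finite (fst G)"
    and col: "\<And>x y. x \<in> fst G \<Longrightarrow> y \<in> fst G \<Longrightarrow> {x, y} \<in> snd G \<Longrightarrow> c x \<noteq> c y"
    and piece: "\<And>a b. a \<in> fst G \<Longrightarrow> b \<in> fst G \<Longrightarrow> a \<noteq> b \<Longrightarrow> {a, b} \<notin> snd G \<Longrightarrow>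
      \<exists>w. set w \<subseteq> fst G \<and> \<not> alternate w a b \<and>
        (\<forall>x\<in>fst G. \<forall>y\<in>fst G. c x < c y \<longrightarrow> {x, y} \<in> snd G \<longrightarrow>
          (\<exists>n. filter (\<lambda>z. z = x \<or> z = y) w = concat (replicate n [x, y])))"
  shows "word_representable G"
proof -
  define M where "M = {(a, b). a \<in> fst G \<and> b \<in> fst G \<and> a \<noteq> b \<and> {a, b} \<notin> snd G}"
  have "finite M"
    by (rule finite_subset[of _ "fst G \<times> fst G"]) (auto simp: M_def assms(1))
  then obtain ms where ms: "set ms = M" using finite_list by blast
  have "\<forall>p\<in>M. \<exists>w. set w \<subseteq> fst G \<and> \<not> alternate w (fst p) (snd p) \<and>
        (\<forall>x\<in>fst G. \<forall>y\<in>fst G. c x < c y \<longrightarrow> {x, y} \<in> snd G \<longrightarrow>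
          (\<exists>n. filter (\<lambda>z. z = x \<or> z = y) w = concat (replicate n [x, y])))"
    using piece unfolding M_def by simp
  then obtain W where W: "\<forall>p\<in>M. set (W p) \<subseteq> fst G \<and> \<not> alternate (W p) (fst p) (snd p) \<and>
        (\<forall>x\<in>fst G. \<forall>y\<in>fst G. c x < c y \<longrightarrow> {x, y} \<in> snd G \<longrightarrow>
          (\<exists>n. filter (\<lambda>z. z = x \<or> z = y) (W p) = concat (replicate n [x, y])))"
    by (rule bchoice[THEN exE])
  define w where "w = concat (map W ms)"
  have ordered: "alternate w x y"
    if "x \<in> fst G" "y \<in> fst G" "c x < c y" "{x, y} \<in> snd G" for x y
  proof -
    have "\<exists>n. filter (\<lambda>z. z = x \<or> z = y) w = concat (replicate n [x, y])"
      unfolding w_def by (rule filter_concat_replicate) (use W ms that in auto)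
    moreover have "x \<noteq> y" using that by auto
    ultimately show ?thesis
      unfolding alternate_def using distinct_adj_concat_replicate by metis
  qed
  show ?thesis
    unfolding word_representable_def
  proof (intro exI[of _ w] conjI ballI impI)
    show "set w \<subseteq> fst G" using W ms by (auto simp: w_def)
  next
    fix x y assume xy: "x \<in> fst G" "y \<in> fst G" "x \<noteq> y"
    show "alternate w x y \<longleftrightarrow> {x, y} \<in> snd G"
    proof
      assume "{x, y} \<in> snd G"
      then show "alternate w x y"
        using ordered[of x y] ordered[of y x] col[OF xy(1,2)] xy alternate_commute[of w x y]
        by (metis insert_commute linorder_neqE_nat)
    next
      assume alt: "alternate w x y"
      show "{x, y} \<in> snd G"
      proof (rule ccontr)
        assume "{x, y} \<notin> snd G"
        then have p: "(x, y) \<in> M" using xy by (simp add: M_def)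
        then have "\<not> alternate (W (x, y)) x y" using W by auto
        moreover obtain us vs where "ms = us @ (x, y) # vs"
          using p ms split_list by metis
        ultimately show False
          using alt not_alternate_append[of "W (x, y)" x y "concat (map W us)" "concat (map W vs)"]
          by (simp add: w_def)
      qed
    qed
  qed
qed

lemma three_colorable_imp_word_representable:
  fixes G :: "'a graph"
  assumes "finite (fst G)" "colorable 3 G"
  shows "word_representable G"
proof -
  from assms(2) obtain c :: "'a \<Rightarrow> nat" where
    c3: "c ` fst G \<subseteq> {..<3}" and
    col: "\<And>x y. x \<in> fst G \<Longrightarrow> y \<in> fst G \<Longrightarrow> {x, y} \<in> snd G \<Longrightarrow> c x \<noteq> c y"
    unfolding colorable_def by blast
  obtain vs where vs: "set vs = fst G" "distinct vs"
    using finite_distinct_list[OF assms(1)] by blast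
  define L where "L k = filter (\<lambda>v. c v = k) vs" for k
  have set_L: "set (L k) = {v \<in> fst G. c v = k}" for k
    using vs by (auto simp: L_def)
  have dist_L: "distinct (L k)" for k using vs by (simp add: L_def)
  have c_cases: "c x = 0 \<or> c x = 1 \<or> c x = 2" if "x \<in> fst G" for x
  proof -
    have "c x < 3" using c3 that by auto
    then show ?thesis by auto
  qed
  let ?Q = "\<lambda>x y z :: 'a. z = x \<or> z = y"
  let ?good = "\<lambda>w. \<forall>x\<in>fst G. \<forall>y\<in>fst G. c x < c y \<longrightarrow> {x, y} \<in> snd G \<longrightarrow>
          (\<exists>n. filter (?Q x y) w = concat (replicate n [x, y]))"
  have twice: "\<exists>n. filter (?Q x y) w = concat (replicate n [x, y])"
    if "filter (?Q x y) w = [x, y, x, y]" for x y w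
    using that by (intro exI[of _ 2]) (simp add: numeral_2_eq_2)
  note fl = filter_doubleton_distinct[OF dist_L]
    filter_doubleton_distinct[OF distinct_removeAll[OF dist_L]]
  \<comment> \<open>Two rounds \<open>L 0 L 1 L 2\<close> restrict to \<open>xyxy\<close> on every
    pair ordered by color. Within this word a copy of \<open>a\<close> and a copy of
    \<open>b\<close> are made neighbours and transposed, which disturbs the pair \<open>a\<close>,
    \<open>b\<close> only.\<close>
  have ordered_piece: "\<exists>w. set w \<subseteq> fst G \<and> \<not> alternate w a b \<and> ?good w"
    if a: "a \<in> fst G" and b: "b \<in> fst G" and lt: "c a < c b" and ne: "{a, b} \<notin> snd G" for a b
  proof -
    have pairs: "(c x = 0 \<and> c y = 1) \<or> (c x = 0 \<and> c y = 2) \<or> (c x = 1 \<and> c y = 2)"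
      if "x \<in> fst G" "y \<in> fst G" "c x < c y" for x y
      using c_cases[OF that(1)] c_cases[OF that(2)] that(3) by auto
    have differ: "x \<noteq> a \<or> y \<noteq> b" if "{x, y} \<in> snd G" for x y using that ne by auto
    consider (01) "c a = 0" "c b = 1" | (02) "c a = 0" "c b = 2" | (12) "c a = 1" "c b = 2"
      using pairs[OF a b lt] by argo
    then show ?thesis
    proof cases
      case 01
      let ?w = "L 0 @ L 1 @ L 2 @ removeAll a (L 0) @ [b, a] @ removeAll b (L 1) @ L 2"
      have "filter (?Q a b) ?w = [a, b, b, a]"
        using a b 01 by (auto simp: fl set_L)
      moreover have "filter (?Q x y) ?w = [x, y, x, y]"
        if "x \<in> fst G" "y \<in> fst G" "c x < c y" "{x, y} \<in> snd G" for x y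
        using pairs[OF that(1-3)] differ[OF that(4)] that(1,2) a b 01
        by (auto simp: fl set_L)
      moreover have "set ?w \<subseteq> fst G" using a b by (auto simp: set_L)
      ultimately show ?thesis
        by (intro exI[of _ ?w] conjI ballI impI twice) (simp_all add: alternate_def)
    next
      case 12
      let ?w = "L 0 @ L 1 @ L 2 @ L 0 @ removeAll a (L 1) @ [b, a] @ removeAll b (L 2)"
      have "filter (?Q a b) ?w = [a, b, b, a]"
        using a b 12 by (auto simp: fl set_L)
      moreover have "filter (?Q x y) ?w = [x, y, x, y]"
        if "x \<in> fst G" "y \<in> fst G" "c x < c y" "{x, y} \<in> snd G" for x y
        using pairs[OF that(1-3)] differ[OF that(4)] that(1,2) a b 12
        by (auto simp: fl set_L)
      moreover have "set ?w \<subseteq> fst G" using a b by (auto simp: set_L)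
      ultimately show ?thesis
        by (intro exI[of _ ?w] conjI ballI impI twice) (simp_all add: alternate_def)
    next
      case 02
      \<comment> \<open>Inside one round \<open>L 1\<close> separates \<open>a\<close> from
        \<open>b\<close>. The transposition therefore takes place at the border of the rounds,
        between the first \<open>b\<close> and the second \<open>a\<close>.\<close>
      let ?w = "L 0 @ L 1 @ removeAll b (L 2) @ [a, b] @ removeAll a (L 0) @ L 1 @ L 2"
      have "filter (?Q a b) ?w = [a, a, b, b]"
        using a b 02 by (auto simp: fl set_L)
      moreover have "filter (?Q x y) ?w = [x, y, x, y]"
        if "x \<in> fst G" "y \<in> fst G" "c x < c y" "{x, y} \<in> snd G" for x y
        using pairs[OF that(1-3)] differ[OF that(4)] that(1,2) a b 02
        by (auto simp: fl set_L)
      moreover have "set ?w \<subseteq> fst G" using a b by (auto simp: set_L)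
      ultimately show ?thesis
        by (intro exI[of _ ?w] conjI ballI impI twice) (simp_all add: alternate_def)
    qed
  qed
  have equal_piece: "\<exists>w. set w \<subseteq> fst G \<and> \<not> alternate w a b \<and> ?good w"
    if a: "a \<in> fst G" and b: "b \<in> fst G" and eq: "c a = c b" for a b
  proof -
    \<comment> \<open>Reversing each class in the second round repeats a letter in the middle of
      \<open>l @ rev l\<close>, while pairs of different colors still see
      \<open>xyxy\<close>.\<close>
    let ?w = "L 0 @ L 1 @ L 2 @ rev (L 0) @ rev (L 1) @ rev (L 2)"
    define l where "l = filter (?Q a b) (L (c a))"
    have l_ne: "l \<noteq> []" using a by (auto simp: l_def filter_empty_conv set_L)
    have empty: "filter (?Q a b) (L k) = []" if "k \<noteq> c a" for k
      using that eq by (auto simp: filter_empty_conv set_L)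
    have "filter (?Q a b) ?w = l @ rev l"
      using c_cases[OF a] by (elim disjE) (simp_all add: l_def empty flip: rev_filter)
    moreover have "\<not> distinct_adj (l @ rev l)"
      using l_ne by (simp add: distinct_adj_append_iff hd_rev)
    moreover have "filter (?Q x y) ?w = [x, y, x, y]"
      if "x \<in> fst G" "y \<in> fst G" "c x < c y" for x y
      using c_cases[OF that(1)] c_cases[OF that(2)] that
      by (elim disjE) (simp_all add: fl set_L flip: rev_filter)
    moreover have "set ?w \<subseteq> fst G" by (auto simp: set_L)
    ultimately show ?thesis
      by (intro exI[of _ ?w] conjI ballI impI twice) (simp_all add: alternate_def)
  qed
  show ?thesis
  proof (rule word_representable_if_pieces[OF assms(1) col])
    fix a b assume ab: "a \<in> fst G" "b \<in> fst G" "a \<noteq> b" "{a, b} \<notin> snd G"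
    then have ba: "{b, a} \<notin> snd G" by (simp add: insert_commute)
    show "\<exists>w. set w \<subseteq> fst G \<and> \<not> alternate w a b \<and> ?good w"
    proof (cases "c a" "c b" rule: linorder_cases)
      case less
      then show ?thesis using ordered_piece[OF ab(1,2) _ ab(4)] by simp
    next
      case equal
      then show ?thesis using equal_piece[OF ab(1,2)] by simp
    next
      case greater
      then show ?thesis
        using ordered_piece[OF ab(2,1) _ ba] unfolding alternate_commute[of _ b a] by simp
    qed
  qed
qed

section \<open>Triangulated polyominoes\<close>

text \<open>The test line runs through cell centers: a center lies in exactly one square, whereas a
  grid line would also meet the neighbouring column.\<close>

lemma column_convex_cells:
  assumes "column_convex P" "(i, j) \<in> P" "(i, j') \<in> P" "j \<le> k" "k \<le> j'"
  shows "(i, k) \<in> P"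
proof (cases "j = j'")
  case True
  then show ?thesis using assms by simp
next
  case False
  \<comment> \<open>The affine parameter of center \<open>k\<close> on the segment from center
    \<open>j\<close> to center \<open>j'\<close>.\<close>
  define u where "u = real_of_int (k - j) / real_of_int (j' - j)"
  have u: "0 \<le> u" "u \<le> 1" "u * real_of_int (j' - j) = real_of_int (k - j)"
    using False assms(4,5) by (auto simp: u_def divide_simps)
  let ?x = "real_of_int i + 1 / 2"
  let ?S = "figure P \<inter> {p. fst p = ?x}"
  have "(?x, real_of_int j + 1 / 2) \<in> ?S" "(?x, real_of_int j' + 1 / 2) \<in> ?S"
    using assms(2,3) by (force simp: figure_def)+
  then have "(1 - u) *\<^sub>R (?x, real_of_int j + 1 / 2) + u *\<^sub>R (?x, real_of_int j' + 1 / 2) \<in> ?S"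
    using assms(1) u unfolding column_convex_def by (intro convexD_alt) auto
  moreover have "(1 - u) *\<^sub>R (?x, real_of_int j + 1 / 2) + u *\<^sub>R (?x, real_of_int j' + 1 / 2)
      = (?x, real_of_int k + 1 / 2)"
    using u(3) by (simp add: algebra_simps add_divide_distrib diff_divide_distrib)
  ultimately obtain a b where ab: "(a, b) \<in> P" "(?x, real_of_int k + 1 / 2) \<in> square (a, b)"
    unfolding figure_def by auto
  then have "a = i" "b = k" by simp_all
  then show ?thesis using ab by simp
qed

lemma row_convex_cells:
  assumes "row_convex P" "(i, j) \<in> P" "(i', j) \<in> P" "i \<le> k" "k \<le> i'"
  shows "(k, j) \<in> P"
proof (cases "i = i'")
  case True
  then show ?thesis using assms by simp
next
  case False
  define u where "u = real_of_int (k - i) / real_of_int (i' - i)"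
  have u: "0 \<le> u" "u \<le> 1" "u * real_of_int (i' - i) = real_of_int (k - i)"
    using False assms(4,5) by (auto simp: u_def divide_simps)
  let ?y = "real_of_int j + 1 / 2"
  let ?S = "figure P \<inter> {p. snd p = ?y}"
  have "(real_of_int i + 1 / 2, ?y) \<in> ?S" "(real_of_int i' + 1 / 2, ?y) \<in> ?S"
    using assms(2,3) by (force simp: figure_def)+
  then have "(1 - u) *\<^sub>R (real_of_int i + 1 / 2, ?y) + u *\<^sub>R (real_of_int i' + 1 / 2, ?y) \<in> ?S"
    using assms(1) u unfolding row_convex_def by (intro convexD_alt) auto
  moreover have "(1 - u) *\<^sub>R (real_of_int i + 1 / 2, ?y) + u *\<^sub>R (real_of_int i' + 1 / 2, ?y)
      = (real_of_int k + 1 / 2, ?y)"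
    using u(3) by (simp add: algebra_simps add_divide_distrib diff_divide_distrib)
  ultimately obtain a b where ab: "(a, b) \<in> P" "(real_of_int k + 1 / 2, ?y) \<in> square (a, b)"
    unfolding figure_def by auto
  then have "a = k" "b = j" by simp_all
  then show ?thesis using ab by simp
qed

section \<open>Convexity on cells and the factorization of signs\<close>

text \<open>If every \<open>2 \<times> 2\<close> block has sign product 1, the ratio of the signs in two adjacent columns
  does not depend on the row; the column signs are the partial products of these ratios.\<close>

lemma sign_factorization:
  fixes \<sigma> :: "cell \<Rightarrow> int"
  assumes "finite P" "column_convex P" "row_convex P"
    and sign: "\<And>p. \<sigma> p = 1 \<or> \<sigma> p = - 1"
    and block: "\<And>i j. (i, j) \<in> P \<Longrightarrow> (i + 1, j) \<in> P \<Longrightarrow> (i, j + 1) \<in> P \<Longrightarrow> (i + 1, j + 1) \<in> P \<Longrightarrow>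
      \<sigma> (i, j) * \<sigma> (i + 1, j) = \<sigma> (i, j + 1) * \<sigma> (i + 1, j + 1)"
  obtains H V :: "int \<Rightarrow> int" where
    "\<And>i. H i = 1 \<or> H i = - 1" "\<And>j. V j = 1 \<or> V j = - 1"
    "\<And>i j. (i, j) \<in> P \<Longrightarrow> \<sigma> (i, j) = H i * V j"
proof -
  obtain m where m: "\<And>i j. (i, j) \<in> P \<Longrightarrow> m \<le> i"
  proof -
    have "bdd_below (fst ` P)" using assms(1) by (intro bdd_below_finite) simp
    then show ?thesis using that unfolding bdd_below_def by force
  qed
  define common where "common i j \<longleftrightarrow> (i, j) \<in> P \<and> (i + 1, j) \<in> P" for i j
  \<comment> \<open>The sign ratio of columns \<open>i\<close> and \<open>i + 1\<close>, read in any
    row containing both cells. Without such a row the value is arbitrary but still a sign, as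
    \<open>t_sign\<close> requires.\<close>
  define t where "t i = (let j = (SOME j. common i j) in \<sigma> (i, j) * \<sigma> (i + 1, j))" for i
  define H where "H i = (\<Prod>k\<in>{m..<i}. t k)" for i
  \<comment> \<open>For signs, \<open>\<sigma> = H * V\<close> is the same as
    \<open>V = \<sigma> * H\<close>; by \<open>row\<close> below, any cell of the row gives the same
    value.\<close>
  define V where "V j = (let i = (SOME i. (i, j) \<in> P) in \<sigma> (i, j) * H i)" for j
  have sq: "\<sigma> p * \<sigma> p = 1" for p using sign[of p] by auto
  \<comment> \<open>Column convexity supplies both cells in every row in between, so equality passes
    from row to row through full blocks.\<close>
  have ratio: "\<sigma> (i, k) * \<sigma> (i + 1, k) = \<sigma> (i, j) * \<sigma> (i + 1, j)"
    if "j \<le> k" "common i j" "common i k" for i j k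
    using that
  proof (induction k rule: int_ge_induct)
    case base
    show ?case by simp
  next
    case (step k)
    then have "common i k"
      unfolding common_def
      using column_convex_cells[OF assms(2), of i j "k + 1" k]
        column_convex_cells[OF assms(2), of "i + 1" j "k + 1" k] by simp
    then show ?case using step block[of i k] by (simp add: common_def)
  qed
  have t: "t i = \<sigma> (i, j) * \<sigma> (i + 1, j)" if "common i j" for i j
  proof -
    have "common i (SOME j. common i j)" using that by (rule someI)
    then show ?thesis
      unfolding t_def Let_def using that ratio linear by metis
  qed
  have t_sign: "t i = 1 \<or> t i = - 1" for i
    unfolding t_def Let_def using sign by (metis mult_1 mult_minus1 minus_minus)
  have "prod t A = 1 \<or> prod t A = - 1" if "finite A" for A
    using that
  proof induction
    case (insert i A)
    then show ?case using t_sign[of i] by auto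
  qed simp
  then have H_sign: "H i = 1 \<or> H i = - 1" for i by (simp add: H_def)
  have H_step: "H (i + 1) = H i * t i" if "m \<le> i" for i
  proof -
    have "{m..<i + 1} = insert i {m..<i}" using that by auto
    then show ?thesis unfolding H_def by (simp add: mult.commute)
  qed
  \<comment> \<open>Moving one cell to the right multiplies both factors by the same sign
    \<open>t k\<close>. Row convexity keeps the path inside \<open>P\<close>.\<close>
  have row: "\<sigma> (k, j) * H k = \<sigma> (i, j) * H i" if "i \<le> k" "(i, j) \<in> P" "(k, j) \<in> P" for i j k
    using that
  proof (induction k rule: int_ge_induct)
    case base
    show ?case by simp
  next
    case (step k)
    then have k: "(k, j) \<in> P" using row_convex_cells[OF assms(3), of i j "k + 1" k] by simp
    then have "t k = \<sigma> (k, j) * \<sigma> (k + 1, j)" using step by (intro t) (simp add: common_def)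
    then have "\<sigma> (k + 1, j) * H (k + 1) = \<sigma> (k, j) * H k"
      using H_step[OF m[OF k]] sq[of "(k + 1, j)"] by (simp add: algebra_simps)
    then show ?case using step k by simp
  qed
  have V_eq: "V j = \<sigma> (i, j) * H i" if "(i, j) \<in> P" for i j
  proof -
    have "((SOME i. (i, j) \<in> P), j) \<in> P" using that by (rule someI)
    then show ?thesis
      unfolding V_def Let_def using that row linear by metis
  qed
  show thesis
  proof
    show "H i = 1 \<or> H i = - 1" for i by (rule H_sign)
    show "V j = 1 \<or> V j = - 1" for j
      unfolding V_def Let_def using sign H_sign by (metis mult_1 mult_minus1 minus_minus)
    show "\<sigma> (i, j) = H i * V j" if "(i, j) \<in> P" for i j
      using V_eq[OF that] H_sign[of i] by auto
  qed
qed

lemma mod_3_neq: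
  fixes a b :: int
  assumes "a - b \<in> {1, -1, 2, -2}"
  shows "nat (a mod 3) \<noteq> nat (b mod 3)"
proof
  assume "nat (a mod 3) = nat (b mod 3)"
  then have "a mod 3 = b mod 3" by (simp add: nat_eq_iff)
  then have "3 dvd a - b" by (simp add: mod_eq_dvd_iff)
  then show False using assms by auto
qed

section \<open>Edges of a fixed triangulation\<close>

context
  fixes P :: "cell set" and D :: "cell \<Rightarrow> point set" and T :: "point graph"
  assumes diag: "\<And>c. c \<in> P \<Longrightarrow> D c \<in> diagonals c"
    and T: "T = (fst (polyomino_graph P), snd (polyomino_graph P) \<union> D ` P)"
begin

definition main_diag :: "cell \<Rightarrow> bool" where
  "main_diag c \<longleftrightarrow> D c = {c, (fst c + 1, snd c + 1)}"

lemma vertices: "fst T = (\<Union>c\<in>P. corners c)"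
  by (simp add: T polyomino_graph_def)

lemma edges: "snd T = (\<Union>c\<in>P. sides c) \<union> D ` P"
  by (simp add: T polyomino_graph_def)

lemma D_eq:
  "(i, j) \<in> P \<Longrightarrow>
    D (i, j) = (if main_diag (i, j) then {(i, j), (i + 1, j + 1)} else {(i + 1, j), (i, j + 1)})"
  using diag[of "(i, j)"] unfolding main_diag_def by simp argo

lemma edge_cases:
  assumes "{x, y} \<in> snd T"
  obtains i j where "(i, j) \<in> P" "{x, y} \<in> sides (i, j)"
  | i j where "(i, j) \<in> P" "main_diag (i, j)" "{x, y} = {(i, j), (i + 1, j + 1)}"
  | i j where "(i, j) \<in> P" "\<not> main_diag (i, j)" "{x, y} = {(i + 1, j), (i, j + 1)}"
proof -
  from assms consider c where "c \<in> P" "{x, y} \<in> sides c" | c where "c \<in> P" "{x, y} = D c"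
    unfolding edges by auto
  then show thesis
  proof cases
    case (1 c)
    then show thesis using that(1)[of "fst c" "snd c"] by simp
  next
    case (2 c)
    then show thesis
      using that(2,3)[of "fst c" "snd c"] D_eq[of "fst c" "snd c"]
      by (cases "main_diag c") simp_all
  qed
qed

text \<open>Serves to exclude chords between rim vertices on opposite sides of a block.\<close>

lemma edge_close:
  assumes "{x, y} \<in> snd T"
  shows "\<bar>fst x - fst y\<bar> \<le> 1 \<and> \<bar>snd x - snd y\<bar> \<le> 1"
  using assms by (cases rule: edge_cases) (auto simp: doubleton_eq_iff)

text \<open>Opposite corners determine their cell and are not joined by a side, so only
  \<open>D (i, j)\<close> can contribute this edge.\<close>

lemma main_diag_edge_iff:
  assumes "(i, j) \<in> P"
  shows "{(i, j), (i + 1, j + 1)} \<in> snd T \<longleftrightarrow> main_diag (i, j)"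
proof
  assume "{(i, j), (i + 1, j + 1)} \<in> snd T"
  then show "main_diag (i, j)"
    by (cases rule: edge_cases) (auto simp: doubleton_eq_iff)
next
  assume "main_diag (i, j)"
  then have "D (i, j) = {(i, j), (i + 1, j + 1)}" by (simp add: D_eq assms)
  then show "{(i, j), (i + 1, j + 1)} \<in> snd T" unfolding edges using assms by (metis UnI2 imageI)
qed

lemma anti_diag_edge_iff:
  assumes "(i, j) \<in> P"
  shows "{(i + 1, j), (i, j + 1)} \<in> snd T \<longleftrightarrow> \<not> main_diag (i, j)"
proof
  assume "{(i + 1, j), (i, j + 1)} \<in> snd T"
  then show "\<not> main_diag (i, j)"
    by (cases rule: edge_cases) (auto simp: doubleton_eq_iff)
next
  assume "\<not> main_diag (i, j)"
  then have "D (i, j) = {(i + 1, j), (i, j + 1)}" by (simp add: D_eq assms)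
  then show "{(i + 1, j), (i, j + 1)} \<in> snd T" unfolding edges using assms by (metis UnI2 imageI)
qed

lemma side_edge:
  assumes "(i, j) \<in> P"
  shows "{(i, j), (i + 1, j)} \<in> snd T" "{(i, j + 1), (i + 1, j + 1)} \<in> snd T"
    "{(i, j), (i, j + 1)} \<in> snd T" "{(i + 1, j), (i + 1, j + 1)} \<in> snd T"
  unfolding edges using assms by (force)+

text \<open>The inner vertex of a \<open>2 \<times> 2\<close> block is the hub of an induced wheel; its rim has odd length
  exactly if an odd number of the four diagonals are main diagonals.\<close>

lemma block_parity:
  assumes "word_representable T"
    and P: "(i, j) \<in> P" "(i + 1, j) \<in> P" "(i, j + 1) \<in> P" "(i + 1, j + 1) \<in> P"
  shows "(main_diag (i, j) \<longleftrightarrow> main_diag (i + 1, j)) \<longleftrightarrow>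
    (main_diag (i, j + 1) \<longleftrightarrow> main_diag (i + 1, j + 1))"
proof (rule ccontr)
  assume odd: "\<not> ?thesis"
  let ?sw = "main_diag (i, j)" and ?se = "main_diag (i + 1, j)"
    and ?nw = "main_diag (i, j + 1)" and ?ne = "main_diag (i + 1, j + 1)"
  \<comment> \<open>The rim, counterclockwise from the south midpoint. A corner of the block is
    listed exactly if the diagonal of its cell joins it to the hub; otherwise that diagonal joins
    the two adjacent midpoints and closes the gap.\<close>
  let ?xs = "(i + 1, j) # (if ?se then [] else [(i + 2, j)]) @ (i + 2, j + 1) #
     (if ?ne then [(i + 2, j + 2)] else []) @ (i + 1, j + 2) #
     (if ?nw then [] else [(i, j + 2)]) @ (i, j + 1) # (if ?sw then [(i, j)] else [])"
  have far: "{x, y} \<notin> snd T" if "\<bar>fst x - fst y\<bar> = 2 \<or> \<bar>snd x - snd y\<bar> = 2" for x y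
    using edge_close[of x y] that by auto
  have two: "i + 1 + 1 = i + 2" "j + 1 + 1 = j + 2" by simp_all
  have comm: "{y, x} \<in> snd T \<longleftrightarrow> {x, y} \<in> snd T" for x y by (simp add: insert_commute)
  note side_facts = P[THEN side_edge(1), unfolded two] P[THEN side_edge(2), unfolded two]
    P[THEN side_edge(3), unfolded two] P[THEN side_edge(4), unfolded two]
  note diag_facts = P[THEN main_diag_edge_iff, unfolded two] P[THEN anti_diag_edge_iff, unfolded two]
  note edge_facts = side_facts side_facts[THEN iffD1[OF comm]]
    diag_facts diag_facts[THEN trans[OF comm]]
  have "\<not> word_representable T"
  proof (rule odd_wheel_not_word_representable)
    show "(i + 1, j + 1) \<in> fst T" using P(1) unfolding vertices by force
    show "set ?xs \<subseteq> fst T" using P unfolding vertices by (force split: if_splits)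
    show "(i + 1, j + 1) \<notin> set ?xs" by simp
    show "odd (length ?xs)" using odd by auto
    show "{(i + 1, j + 1), u} \<in> snd T" if "u \<in> set ?xs" for u
      using that by (auto simp: edge_facts split: if_splits)
    show "x \<noteq> y \<and> {x, y} \<in> snd T" if "(x, y) \<in> set (zip ?xs (rotate 1 ?xs))" for x y
      using that odd by (auto simp: edge_facts split: if_splits)
    \<comment> \<open>Rim vertices two apart differ by 2 in some coordinate, or are the midpoints
      around a listed corner, whose cell has its diagonal at the hub instead.\<close>
    show "x \<noteq> y \<and> {x, y} \<notin> snd T" if "(x, y) \<in> set (zip ?xs (rotate 2 ?xs))" for x y
      using that odd by (auto simp: edge_facts far numeral_2_eq_2 split: if_splits)
  qed
  then show False using assms(1) by contradiction
qed

section \<open>The coloring by a height function modulo 3\<close>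

lemma word_representable_imp_three_colorable:
  assumes "word_representable T" "finite P" "column_convex P" "row_convex P"
  shows "colorable 3 T"
proof -
  define \<sigma> :: "cell \<Rightarrow> int" where "\<sigma> c = (if main_diag c then 1 else - 1)" for c
  obtain H V :: "int \<Rightarrow> int" where
    H: "\<And>i. H i = 1 \<or> H i = - 1" and V: "\<And>j. V j = 1 \<or> V j = - 1" and
    HV: "\<And>i j. (i, j) \<in> P \<Longrightarrow> \<sigma> (i, j) = H i * V j"
  proof (rule sign_factorization[OF assms(2-4)])
    show "\<sigma> p = 1 \<or> \<sigma> p = - 1" for p by (simp add: \<sigma>_def)
  next
    fix i j
    assume "(i, j) \<in> P" "(i + 1, j) \<in> P" "(i, j + 1) \<in> P" "(i + 1, j + 1) \<in> P"
    from block_parity[OF assms(1) this]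
    show "\<sigma> (i, j) * \<sigma> (i + 1, j) = \<sigma> (i, j + 1) * \<sigma> (i + 1, j + 1)"
      by (auto simp: \<sigma>_def)
  qed blast
  \<comment> \<open>A common lower bound for both coordinates of all cells serves as the starting
    point of both sums.\<close>
  have "finite (fst ` P \<union> snd ` P)" using assms(2) by simp
  then obtain m where m: "\<And>x. x \<in> fst ` P \<union> snd ` P \<Longrightarrow> m \<le> x"
    using bdd_below_finite unfolding bdd_below_def by metis
  have ge: "m \<le> i" "m \<le> j" if "(i, j) \<in> P" for i j
    using m[of i] m[of j] that by force+
  define S where "S h i = (\<Sum>k\<in>{m..<i}. h k)" for h :: "int \<Rightarrow> int" and i
  have S: "S h (i + 1) = S h i + h i" if "m \<le> i" for h i
  proof -
    have "{m..<i + 1} = insert i {m..<i}" using that by auto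
    then show ?thesis unfolding S_def by simp
  qed
  define g where "g p = S H (fst p) + S V (snd p)" for p
  have g: "g (i + 1, j) = g (i, j) + H i" "g (i, j + 1) = g (i, j) + V j"
    "g (i + 1, j + 1) = g (i, j) + H i + V j" if "(i, j) \<in> P" for i j
    using S[OF ge(1)[OF that]] S[OF ge(2)[OF that]] by (simp_all add: g_def)
  \<comment> \<open>Sides change \<open>g\<close> by one sign. A main diagonal has
    \<open>H i = V j\<close> and changes it by their sum; an antidiagonal has
    \<open>H i = - V j\<close> and changes it by their difference. Both are 2 or -2, never a
    multiple of 3.\<close>
  have "g x - g y \<in> {1, -1, 2, -2}" if "{x, y} \<in> snd T" for x y
    using that
  proof (cases rule: edge_cases)
    case (1 i j)
    then show ?thesis using g[OF 1(1)] H[of i] V[of j] by (auto simp: doubleton_eq_iff)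
  next
    case (2 i j)
    then have "H i * V j = 1" using HV[OF 2(1)] by (simp add: \<sigma>_def)
    then have "H i = V j" using H[of i] V[of j] by auto
    then show ?thesis using 2 g[OF 2(1)] V[of j] by (auto simp: doubleton_eq_iff)
  next
    case (3 i j)
    then have "H i * V j = - 1" using HV[OF 3(1)] by (simp add: \<sigma>_def)
    then have "H i = - V j" using H[of i] V[of j] by auto
    then show ?thesis using 3 g[OF 3(1)] V[of j] by (auto simp: doubleton_eq_iff)
  qed
  then have "nat (g x mod 3) \<noteq> nat (g y mod 3)" if "{x, y} \<in> snd T" for x y
    using that mod_3_neq by blast
  moreover have "(\<lambda>x. nat (g x mod 3)) ` fst T \<subseteq> {..<3}"
    by (auto simp: nat_less_iff)
  ultimately show ?thesis
    unfolding colorable_def by (intro exI[of _ "\<lambda>x. nat (g x mod 3)"]) blast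
qed

end

theorem theorem3:
  fixes P :: "cell set" and T :: "point graph"
  assumes "convex_polyomino P"
    and "triangulation_of P T"
  shows "word_representable T \<longleftrightarrow> colorable 3 T"
proof -
  from assms(1) have P: "finite P" "column_convex P" "row_convex P"
    by (auto simp: convex_polyomino_def polyomino_def)
  from assms(2) obtain D where D: "\<forall>c\<in>P. D c \<in> diagonals c"
    and T: "T = (fst (polyomino_graph P), snd (polyomino_graph P) \<union> D ` P)"
    unfolding triangulation_of_def by (elim exE conjE)
  have "finite (fst T)" using P(1) by (auto simp: T polyomino_graph_def)
  then show ?thesis
    using three_colorable_imp_word_representable
      word_representable_imp_three_colorable[OF bspec[OF D] T _ P] by blast
qed

end
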